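(* Let $X$ be a set and let $\mathscr{F}$ be a collection of subsets of $X$. Then $$\eta(X,\mathscr{F}) \leq 1+\tau(X,\mathscr{F}),$$ where $\eta(X,\mathscr{F})$ is the colorful Helly number and $\tau(X,\mathscr{F})$ is the comatching number of $(X,\mathscr{F})$.
   Context: The colorful Helly number $\eta(X,\mathscr{F})$ is the minimum positive integer $\eta$ for which the following holds: if finite subfamilies $\mathscr{F}_1,\ldots,\mathscr{F}_\eta\subset\mathscr{F}$ are such that $\bigcap_{F\in\mathscr{F}_i}F=\emptyset$ for every $i=1,\ldots,\eta$, then there exist $F_i\in\mathscr{F}_i$ ($1\le i\le \eta$) such that $F_1\cap\cdots\cap F_\eta=\emptyset$. If no such integer exists, $\eta(X,\mathscr{F})=\infty$. The bipartite complement of the incidence graph of $(X,\mathscr{F})$ is the bipartite graph on $X\cup\mathscr{F}$ in which $(x,F)\in X\times\mathscr{F}$ is an edge if $x\notin F$. The comatching number $\tau(X,\mathscr{F})$ is the maximum size of an induced matching in this graph, i.e. the largest $k$ such that there exist $x_1,\ldots,x_k\in X$ and $F_1,\ldots,F_k\in\mathscr{F}$ with $x_i\in F_j$ if and only if $i\neq j$ (for all $i,j\in\{1,\ldots,k\}$). *)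

theory Defs
  imports Main "HOL-Library.Extended_Nat"
begin

text \<open>Intersections are taken inside the ground set \<open>X\<close>. The condition \<open>\<G> i \<noteq> {}\<close>
  matters only for \<open>X = {}\<close>: if \<open>X \<noteq> {}\<close>, the empty subfamily has intersection \<open>X\<close>
  and is excluded anyway, whereas for \<open>X = {}\<close> it would have empty intersection although
  nothing can be chosen from it, so that no \<open>n\<close> at all would have the property.\<close>

definition colorful_helly_property :: "'a set \<Rightarrow> 'a set set \<Rightarrow> nat \<Rightarrow> bool" where
  "colorful_helly_property X \<F> n \<longleftrightarrow>
     (\<forall>\<G> :: nat \<Rightarrow> 'a set set.
        (\<forall>i\<in>{1..n}. finite (\<G> i) \<and> \<G> i \<subseteq> \<F> \<and> \<G> i \<noteq> {} \<and> X \<inter> \<Inter> (\<G> i) = {}) \<longrightarrow>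
        (\<exists>F :: nat \<Rightarrow> 'a set. (\<forall>i\<in>{1..n}. F i \<in> \<G> i) \<and> X \<inter> (\<Inter>i\<in>{1..n}. F i) = {}))"

definition colorful_helly_number :: "'a set \<Rightarrow> 'a set set \<Rightarrow> enat" where
  "colorful_helly_number X \<F> =
     (if \<exists>n\<ge>1. colorful_helly_property X \<F> n
      then enat (LEAST n. n \<ge> 1 \<and> colorful_helly_property X \<F> n) else \<infinity>)"

definition has_comatching :: "'a set \<Rightarrow> 'a set set \<Rightarrow> nat \<Rightarrow> bool" where
  "has_comatching X \<F> k \<longleftrightarrow>
     (\<exists>(x :: nat \<Rightarrow> 'a) (F :: nat \<Rightarrow> 'a set).
        (\<forall>i\<in>{1..k}. x i \<in> X \<and> F i \<in> \<F>) \<and>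
        (\<forall>i\<in>{1..k}. \<forall>j\<in>{1..k}. x i \<in> F j \<longleftrightarrow> i \<noteq> j))"

text \<open>The supremum is a maximum if the sizes are bounded (\<open>k = 0\<close> always occurs), and
  \<open>\<infinity>\<close> if there are comatchings of arbitrarily large size.\<close>

definition comatching_number :: "'a set \<Rightarrow> 'a set set \<Rightarrow> enat" where
  "comatching_number X \<F> = Sup (enat ` {k. has_comatching X \<F> k})"

end

theory Submission imports Defs "HOL-Library.FuncSet" begin

text \<open>The idea is extremal. Call a choice of one member from each of \<open>n\<close> finite subfamilies,
  each with empty intersection, a rainbow choice. Among the finitely many rainbow choices take
  one whose intersection is minimal with respect to inclusion, and suppose that this intersection
  still contains a point \<open>x\<close>. The \<open>i\<close>-th subfamily has a member avoiding \<open>x\<close>; substituting it for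
  the \<open>i\<close>-th chosen set removes \<open>x\<close> from the intersection, so by minimality the substitution must
  bring in some new point \<open>p\<^sub>i\<close>. Such a point lies in every chosen set except the \<open>i\<close>-th. Hence the
  points \<open>p\<^sub>i\<close> and the chosen sets form a comatching of size \<open>n\<close>. So, for each \<open>n\<close>, either the
  colorful Helly property holds for \<open>n\<close> or there is a comatching of size \<open>n\<close>, and the bound follows
  by taking \<open>n\<close> to be one more than the comatching number when that is finite.\<close>

lemma exists_minimal_rainbow_intersection:
  fixes \<G> :: "'i \<Rightarrow> 'a set set"
  assumes "finite I" and "\<And>i. i \<in> I \<Longrightarrow> finite (\<G> i)" and "\<And>i. i \<in> I \<Longrightarrow> \<G> i \<noteq> {}"
  shows "\<exists>F. (\<forall>i\<in>I. F i \<in> \<G> i) \<and>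
    (\<forall>F'. (\<forall>i\<in>I. F' i \<in> \<G> i) \<longrightarrow> \<not> X \<inter> (\<Inter>i\<in>I. F' i) \<subset> X \<inter> (\<Inter>i\<in>I. F i))"
proof -
  define cap where "cap F = X \<inter> (\<Inter>i\<in>I. F i)" for F :: "'i \<Rightarrow> 'a set"
  have "finite (cap ` PiE I \<G>)"
    using assms by (intro finite_imageI finite_PiE)
  moreover have "cap ` PiE I \<G> \<noteq> {}"
    using assms by (simp add: PiE_eq_empty_iff)
  ultimately obtain M where M: "M \<in> cap ` PiE I \<G>"
    and min: "\<forall>N\<in>cap ` PiE I \<G>. N \<subseteq> M \<longrightarrow> M = N"
    using finite_has_minimal by metis
  from M obtain F where F: "F \<in> PiE I \<G>" and MF: "M = cap F"
    by blast
  have "\<not> cap F' \<subset> cap F" if F': "\<forall>i\<in>I. F' i \<in> \<G> i" for F'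
  proof -
    \<comment> \<open>Extensional functions make the set of rainbow choices finite; the intersection only sees
      the values on \<open>I\<close>.\<close>
    have "restrict F' I \<in> PiE I \<G>" and "cap (restrict F' I) = cap F'"
      using F' by (simp_all add: cap_def)
    then have "cap F' \<in> cap ` PiE I \<G>"
      by (metis imageI)
    then show ?thesis
      using min MF by blast
  qed
  then show ?thesis
    using F unfolding cap_def by (intro exI[of _ F] conjI) (auto simp: PiE_iff)
qed

text \<open>A minimal rainbow intersection is locally minimal under exchanging a single chosen set, and
  each of the \<open>n\<close> exchanges that would remove a given point produces one point of the comatching.\<close>

lemma colorful_helly_property_or_has_comatching:
  fixes X :: "'a set"
  shows "colorful_helly_property X \<F> n \<or> has_comatching X \<F> n"
proof (rule disjCI)
  assume no_comatching: "\<not> has_comatching X \<F> n"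
  show "colorful_helly_property X \<F> n"
    unfolding colorful_helly_property_def
  proof (intro allI impI)
    fix \<G> :: "nat \<Rightarrow> 'a set set"
    assume \<G>: "\<forall>i\<in>{1..n}. finite (\<G> i) \<and> \<G> i \<subseteq> \<F> \<and> \<G> i \<noteq> {} \<and> X \<inter> \<Inter> (\<G> i) = {}"
    define cap where "cap F = X \<inter> (\<Inter>i\<in>{1..n}. F i)" for F :: "nat \<Rightarrow> 'a set"
    have "\<exists>F. (\<forall>i\<in>{1..n}. F i \<in> \<G> i) \<and>
        (\<forall>F'. (\<forall>i\<in>{1..n}. F' i \<in> \<G> i) \<longrightarrow> \<not> cap F' \<subset> cap F)"
      unfolding cap_def using \<G> by (intro exists_minimal_rainbow_intersection) blast+
    then obtain F where F: "\<And>i. i \<in> {1..n} \<Longrightarrow> F i \<in> \<G> i"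
      and min: "\<And>F'. \<forall>i\<in>{1..n}. F' i \<in> \<G> i \<Longrightarrow> \<not> cap F' \<subset> cap F"
      by blast
    have "cap F = {}"
    proof (rule ccontr)
      assume "cap F \<noteq> {}"
      then obtain x where x: "x \<in> cap F"
        by blast
      have "\<exists>p. p \<in> X \<and> (\<forall>j\<in>{1..n}. p \<in> F j \<longleftrightarrow> i \<noteq> j)" if i: "i \<in> {1..n}" for i
      proof -
        have "x \<in> X" and "X \<inter> \<Inter> (\<G> i) = {}"
          using x \<G> i by (simp_all add: cap_def)
        then obtain B where B: "B \<in> \<G> i" "x \<notin> B"
          by blast
        let ?F' = "F(i := B)"
        have "x \<notin> cap ?F'"
          using B(2) i fun_upd_same[of F i B] unfolding cap_def by blast
        moreover have "\<forall>j\<in>{1..n}. ?F' j \<in> \<G> j"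
          using F B(1) by simp
        ultimately have "\<not> cap ?F' \<subseteq> cap F"
          using min x by blast
        then obtain p where p: "p \<in> X" "\<And>j. j \<in> {1..n} \<Longrightarrow> p \<in> ?F' j" "p \<notin> cap F"
          unfolding cap_def by blast
        have others: "p \<in> F j" if "j \<in> {1..n}" "j \<noteq> i" for j
          using p(2)[OF that(1)] that(2) by simp
        moreover have "p \<notin> F i"
          using p(1,3) others unfolding cap_def by blast
        ultimately show ?thesis
          using p(1) by blast
      qed
      then obtain p where "\<And>i. i \<in> {1..n} \<Longrightarrow> p i \<in> X \<and> (\<forall>j\<in>{1..n}. p i \<in> F j \<longleftrightarrow> i \<noteq> j)"
        by metis
      moreover have "F i \<in> \<F>" if "i \<in> {1..n}" for i
        using F \<G> that by blast
      ultimately have "has_comatching X \<F> n"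
        unfolding has_comatching_def by blast
      with no_comatching show False ..
    qed
    with F show "\<exists>F. (\<forall>i\<in>{1..n}. F i \<in> \<G> i) \<and> X \<inter> (\<Inter>i\<in>{1..n}. F i) = {}"
      unfolding cap_def by blast
  qed
qed

lemma colorful_helly_number_le:
  assumes "n \<ge> 1" and "colorful_helly_property X \<F> n"
  shows "colorful_helly_number X \<F> \<le> enat n"
  using assms unfolding colorful_helly_number_def by (auto intro: Least_le)

lemma has_comatching_le_comatching_number:
  "has_comatching X \<F> k \<Longrightarrow> enat k \<le> comatching_number X \<F>"
  unfolding comatching_number_def by (auto intro: Sup_upper)

theorem theorem1p1:
  fixes X :: "'a set" and \<F> :: "'a set set"
  assumes "\<F> \<subseteq> Pow X"
  shows "colorful_helly_number X \<F> \<le> 1 + comatching_number X \<F>"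
proof (cases "comatching_number X \<F>")
  case (enat k)
  have "\<not> has_comatching X \<F> (Suc k)"
    using has_comatching_le_comatching_number[of X \<F> "Suc k"] enat by auto
  then have "colorful_helly_property X \<F> (Suc k)"
    using colorful_helly_property_or_has_comatching by blast
  then have "colorful_helly_number X \<F> \<le> enat (Suc k)"
    by (intro colorful_helly_number_le) auto
  then show ?thesis
    by (simp add: enat one_enat_def)
next
  case infinity
  then show ?thesis
    by simp
qed

end
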